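(* (Schur's complement theorem.) Let $M$ be the generator matrix of $\widetilde{\mathcal{M}}_{m|n}$, written in block form $$M=\begin{pmatrix} M_{11} & M_{12} \\ M_{21} & M_{22} \end{pmatrix}$$ where $M_{11}$ and $M_{22}$ are submatrices of size $k\times k$ and $(m+n-k)\times(m+n-k)$ respectively. Then $$\mathrm{Ber}_q(M)=\mathrm{Ber}_q(M_{11})\,\mathrm{Ber}_q\big(M_{22}-M_{21}M_{11}^{-1}M_{12}\big).$$
   Context: Let $q$ be a nonzero parameter, $m,n\ge0$ integers, $[k]=\{1,\dots,k\}$. An index $i\in[m+n]$ has parity $\bar i=0$ if $i\le m$ and $\bar i=1$ if $i>m$. Put $\varepsilon(a)=1,0,-1$ according to $a>0,a=0,a<0$. $l(\sigma)$ is the number of inversions of a permutation. A matrix $A=(A_{ij})_{i,j\in[m+n]}$ over a superalgebra, $A_{ij}$ of parity $\bar i+\bar j$, satisfies the relations $R^q$ (is a $q$-super Manin matrix of type $m|n$) if: (1) $A_{ij}^2=0$ if $\bar i=1,\bar j=0$; (2) $A_{ik}A_{il}=q^{\varepsilon(l-k)}(-1)^{(\bar k+1)(\bar l+1)}A_{il}A_{ik}$ if $\bar i=1$; (3) $A_{ik}A_{jk}=q^{\varepsilon(i-j)}(-1)^{\bar i\bar j}A_{jk}A_{ik}$ if $\bar k=0$; (4) for all $i,j,k,l$: $A_{ij}A_{kl}-q^{\varepsilon(i-k)+\varepsilon(l-j)}(-1)^{(\bar i+\bar j)(\bar k+\bar l)}A_{kl}A_{ij}=q^{\varepsilon(i-k)}(-1)^{\bar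 i\bar k+\bar j\bar k+\bar i\bar j}A_{kj}A_{il}-q^{\varepsilon(l-j)}(-1)^{\bar j\bar k+\bar j\bar l+\bar k\bar l}A_{il}A_{kj}$. The supertranspose is $(A^{st})_{ij}=(-1)^{\bar i(\bar i+\bar j)}A_{ji}$. $\widetilde{\mathcal{M}}_{m|n}$ is the unital associative superalgebra generated by the entries of two matrices $M$ and $M^{-1}$ ($(i,j)$ entries of parity $\bar i+\bar j$) subject to: $M$ satisfies $R^q$; $M^{-1}$ satisfies $R^{q^{-1}}$ (i.e. $R^q$ with $q$ replaced by $q^{-1}$); $MM^{-1}=M^{-1}M=1$; and $M^{st}(M^{-1})^{st}=(M^{-1})^{st}M^{st}=1$. For an invertible matrix $A$ of type $r|s$ (first $r$ indices even, last $s$ odd) the quantum Berezinian is $$\mathrm{Ber}_q(A)=\sum_{\sigma\in\mathfrak{S}_r}(-q)^{-l(\sigma)}A_{\sigma(1),1}\cdots A_{\sigma(r),r}\times\sum_{\rho\in\mathfrak{S}_s}(-q)^{-l(\rho)}(A^{-1})_{r+1,r+\rho(1)}\cdots(A^{-1})_{r+s,r+\rho(s)}$$ (sums over $\mathfrak{S}_0$ equal $1$). Rows and columns of $M_{11}$ and of $M_{22}-M_{21}M_{11}^{-1}M_{12}$ keep the parities of the corresponding indices of $M$: if $k\le m$ these matrices have types $k|0$ and $(m-k)|n$; if $k\ge m$ they have types $m|(k-m)$ and $0|(m+n-k)$. Standing conventions: all inverses of submatrices, quasideterminants and Berezinians that are needed are assumed to exist (in a suitable extension of $\widetilde{\mathcal{M}}_{m|n}$),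 and a principal submatrix of type $r|s$ of $M$ together with its inverse is regarded as the generator matrix of $\widetilde{\mathcal{M}}_{r|s}$ together with its antipode image (i.e. they satisfy the defining relations of $\widetilde{\mathcal{M}}_{r|s}$); likewise for principal submatrices of $M^{-1}$ with $q$ replaced by $q^{-1}$. *)

theory Defs
  imports "HOL-Combinatorics.Permutations" "Jordan_Normal_Form.Matrix"
begin

text \<open>
  All indices are counted from 0, as in \<open>Jordan_Normal_Form.Matrix\<close>; the relations depend on
  indices only through parities and signs of differences, so this shift is harmless.
\<close>

text \<open>
  An associative unital superalgebra over a field: \<open>G 0\<close> is the even part, \<open>G 1\<close> the odd part
  (other values of \<open>G\<close> are irrelevant).
\<close>

locale superalgebra = vector_space scale
  for scale :: "'k::field \<Rightarrow> 'a::ring_1 \<Rightarrow> 'a" +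
  fixes G :: "nat \<Rightarrow> 'a set"
  assumes scale_mult_left: "scale c x * y = scale c (x * y)"
    and scale_mult_right: "x * scale c y = scale c (x * y)"
    and subspace_even: "subspace (G 0)"
    and subspace_odd: "subspace (G 1)"
    and parts_disjoint: "G 0 \<inter> G 1 = {0}"
    and parts_span: "\<exists>y\<in>G 0. \<exists>z\<in>G 1. x = y + z"
    and one_even: "1 \<in> G 0"
    and mult_parity: "a \<in> {0, 1} \<Longrightarrow> b \<in> {0, 1} \<Longrightarrow> x \<in> G a \<Longrightarrow> y \<in> G b
      \<Longrightarrow> x * y \<in> G ((a + b) mod 2)"

definition par :: "nat \<Rightarrow> nat \<Rightarrow> nat" where
  "par m i = (if i < m then 0 else 1)"

definition eps :: "nat \<Rightarrow> nat \<Rightarrow> int" where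
  "eps i j = sgn (int i - int j)"

text \<open>
  Relations \<open>R\<^sup>q\<close> for a matrix of type \<open>m|n\<close>. Products of entries are rescaled by elements of
  the ground field; \<open>eps i j\<close> stands for \<open>\<epsilon>(i - j)\<close>.
\<close>

definition q_super_manin ::
  "('k::field \<Rightarrow> 'a::ring_1 \<Rightarrow> 'a) \<Rightarrow> (nat \<Rightarrow> 'a set) \<Rightarrow> 'k \<Rightarrow> nat \<Rightarrow> nat \<Rightarrow> 'a mat \<Rightarrow> bool" where
  "q_super_manin scale G q m n A \<longleftrightarrow>
    A \<in> carrier_mat (m + n) (m + n) \<and>
    (\<forall>i<m+n. \<forall>j<m+n. A $$ (i, j) \<in> G ((par m i + par m j) mod 2)) \<and>
    (\<forall>i<m+n. \<forall>j<m+n. par m i = 1 \<and> par m j = 0 \<longrightarrow> A $$ (i, j) * A $$ (i, j) = 0) \<and>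
    (\<forall>i<m+n. \<forall>k<m+n. \<forall>l<m+n. par m i = 1 \<longrightarrow>
      A $$ (i, k) * A $$ (i, l) =
        scale (q powi eps l k * (-1) ^ ((par m k + 1) * (par m l + 1)))
          (A $$ (i, l) * A $$ (i, k))) \<and>
    (\<forall>i<m+n. \<forall>j<m+n. \<forall>k<m+n. par m k = 0 \<longrightarrow>
      A $$ (i, k) * A $$ (j, k) =
        scale (q powi eps i j * (-1) ^ (par m i * par m j))
          (A $$ (j, k) * A $$ (i, k))) \<and>
    (\<forall>i<m+n. \<forall>j<m+n. \<forall>k<m+n. \<forall>l<m+n.
      A $$ (i, j) * A $$ (k, l)
        - scale (q powi (eps i k + eps l j) *
              (-1) ^ ((par m i + par m j) * (par m k + par m l)))
            (A $$ (k, l) * A $$ (i, j)) =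
      scale (q powi eps i k *
            (-1) ^ (par m i * par m k + par m j * par m k + par m i * par m j))
          (A $$ (k, j) * A $$ (i, l))
        - scale (q powi eps l j *
              (-1) ^ (par m j * par m k + par m j * par m l + par m k * par m l))
            (A $$ (i, l) * A $$ (k, j)))"

definition supertranspose :: "nat \<Rightarrow> 'a::ring_1 mat \<Rightarrow> 'a mat" where
  "supertranspose m A = mat (dim_col A) (dim_row A)
     (\<lambda>(i, j). (-1) ^ (par m i * (par m i + par m j)) * A $$ (j, i))"

text \<open>
  The defining relations of \<open>\<M>\<close>-tilde of type \<open>m|n\<close> for a pair \<open>(M, N)\<close>, where \<open>N\<close> plays the
  role of \<open>M\<^sup>-\<^sup>1\<close>. By the universal property of the presented algebra, such a pair in a
  superalgebra is the same as a parity-preserving algebra homomorphism from \<open>\<M>\<close>-tilde to it.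
\<close>

definition generator_pair ::
  "('k::field \<Rightarrow> 'a::ring_1 \<Rightarrow> 'a) \<Rightarrow> (nat \<Rightarrow> 'a set) \<Rightarrow> 'k \<Rightarrow> nat \<Rightarrow> nat \<Rightarrow> 'a mat \<Rightarrow> 'a mat \<Rightarrow> bool" where
  "generator_pair scale G q m n M N \<longleftrightarrow>
    q_super_manin scale G q m n M \<and>
    q_super_manin scale G (inverse q) m n N \<and>
    M * N = 1\<^sub>m (m + n) \<and> N * M = 1\<^sub>m (m + n) \<and>
    supertranspose m M * supertranspose m N = 1\<^sub>m (m + n) \<and>
    supertranspose m N * supertranspose m M = 1\<^sub>m (m + n)"

text \<open>
  The two-sided inverse, unique whenever it exists; meaningful only if \<open>invertible_mat A\<close>.
\<close>

definition mat_inv :: "'a::ring_1 mat \<Rightarrow> 'a mat" where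
  "mat_inv A = (THE B. B \<in> carrier_mat (dim_col A) (dim_row A) \<and> inverts_mat A B \<and> inverts_mat B A)"

definition inversions :: "nat \<Rightarrow> (nat \<Rightarrow> nat) \<Rightarrow> nat" where
  "inversions r \<sigma> = card {(i, j). i < j \<and> j < r \<and> \<sigma> j < \<sigma> i}"

definition Ber :: "('k::field \<Rightarrow> 'a::ring_1 \<Rightarrow> 'a) \<Rightarrow> 'k \<Rightarrow> nat \<Rightarrow> nat \<Rightarrow> 'a mat \<Rightarrow> 'a" where
  "Ber scale q r s A =
    (\<Sum>\<sigma> | \<sigma> permutes {..<r}. scale ((- q) powi (- int (inversions r \<sigma>)))
        (prod_list (map (\<lambda>j. A $$ (\<sigma> j, j)) [0..<r]))) *
    (\<Sum>\<rho> | \<rho> permutes {..<s}. scale ((- q) powi (- int (inversions s \<rho>)))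
        (prod_list (map (\<lambda>i. mat_inv A $$ (r + i, r + \<rho> i)) [0..<s])))"

end

theory Submission
  imports Defs "HOL-Combinatorics.Multiset_Permutations"
begin

text \<open>
  The Berezinian is the column determinant of the even block of \<open>M\<close> times the row determinant of
  the odd block of \<open>M\<^sup>-\<^sup>1\<close>. If \<open>k \<le> m\<close>, the inverse of the Schur complement is the lower right block of
  \<open>M\<^sup>-\<^sup>1\<close>, so the odd factors agree and the claim is the Schur complement formula for the column
  determinant of the even block of \<open>M\<close>. If \<open>k \<ge> m\<close>, the even factors agree and the claim is the
  Schur complement formula for the row determinant of the odd block of \<open>M\<^sup>-\<^sup>1\<close>, where the Schur
  complement of \<open>(M\<^sup>-\<^sup>1)\<^sub>2\<^sub>2\<close> is \<open>M\<^sub>1\<^sub>1\<^sup>-\<^sup>1\<close>. Both formulas come from one identity in a quantum exterior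
  algebra: a determinant is the coefficient of the product of the vectors \<open>\<phi>\<^sub>j\<close> given by the columns,
  these vectors commute up to scalars and have square zero, so each \<open>\<phi>\<^sub>j\<close> with \<open>j \<ge> k\<close> may be reduced
  modulo the first \<open>k\<close> of them.
\<close>

section \<open>Inversions, and permutations as lists\<close>

text \<open>Serves the product with two vectors, where a pair of generators arises in both orders;
  the two contributions are gathered at \<open>a < b\<close>.\<close>

lemma sum_distinct_pairs:
  fixes g :: "nat \<Rightarrow> nat \<Rightarrow> 'a::comm_monoid_add"
  assumes "finite J"
  shows "(\<Sum>l\<in>J. \<Sum>l'\<in>J - {l}. g l l') =
    (\<Sum>(a, b) | a \<in> J \<and> b \<in> J \<and> a < b. g b a + g a b)"
proof -
  let ?P = "{(a, b). a \<in> J \<and> b \<in> J \<and> a < b}"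
  let ?Q = "{(a, b). a \<in> J \<and> b \<in> J \<and> b < a}"
  have fin: "finite ?P" "finite ?Q"
    by (rule finite_subset[of _ "J \<times> J"]; use assms in auto)+
  have "(\<Sum>l\<in>J. \<Sum>l'\<in>J - {l}. g l l') = (\<Sum>(l, l')\<in>(SIGMA l:J. J - {l}). g l l')"
    using assms by (simp add: sum.Sigma)
  also have "(SIGMA l:J. J - {l}) = ?P \<union> ?Q"
    by auto
  also have "(\<Sum>(l, l')\<in>?P \<union> ?Q. g l l') = (\<Sum>(l, l')\<in>?P. g l l') + (\<Sum>(l, l')\<in>?Q. g l l')"
    by (rule sum.union_disjoint) (use fin in auto)
  also have "(\<Sum>(l, l')\<in>?Q. g l l') = (\<Sum>(a, b)\<in>?P. g b a)"
    by (rule sum.reindex_bij_witness[of _ prod.swap prod.swap]) auto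
  finally show ?thesis
    by (simp only: sum.distrib split_def add.commute)
qed

lemma inversions_0 [simp]: "inversions 0 f = 0"
  by (simp add: inversions_def)

lemma inversions_Suc: "inversions (Suc t) f = inversions t f + card {i. i < t \<and> f t < f i}"
proof -
  have "{(i, j). i < j \<and> j < Suc t \<and> f j < f i} =
      {(i, j). i < j \<and> j < t \<and> f j < f i} \<union> (\<lambda>i. (i, t)) ` {i. i < t \<and> f t < f i}"
    by (auto simp: less_Suc_eq)
  moreover have "finite {(i, j). i < j \<and> j < t \<and> f j < f i}"
    by (rule finite_subset[of _ "{..<t} \<times> {..<t}"]) auto
  ultimately show ?thesis
    unfolding inversions_def
    by (simp add: card_Un_disjoint card_image inj_on_def disjoint_iff image_iff)
qed

lemma inversions_cong: "(\<And>i. i < t \<Longrightarrow> f i = g i) \<Longrightarrow> inversions t f = inversions t g"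
  unfolding inversions_def by (rule arg_cong[of _ _ card]) auto

text \<open>\<open>wedge\<close> appends factors on the right, so inductions must split off the last
  entry; reversal transfers the recursion on the first entry.\<close>

lemma permutations_of_set_snoc:
  assumes "J \<noteq> {}"
  shows "permutations_of_set J = (\<Union>l\<in>J. (\<lambda>ys. ys @ [l]) ` permutations_of_set (J - {l}))"
proof -
  have "permutations_of_set J = rev ` permutations_of_set J"
    by simp
  also have "\<dots> = (\<Union>l\<in>J. (\<lambda>ys. ys @ [l]) ` rev ` permutations_of_set (J - {l}))"
    by (subst permutations_of_set_nonempty[OF assms])
      (simp add: image_UN image_image del: rev_permutations_of_set)
  finally show ?thesis
    by simp
qed

lemma bij_betw_permutes_permutations_of_set:
  "bij_betw (\<lambda>\<sigma>. map \<sigma> [0..<t]) {\<sigma>. \<sigma> permutes {..<t}} (permutations_of_set {..<t})"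
proof (rule bij_betw_byWitness[of _ "\<lambda>xs i. if i < t then xs ! i else i"])
  show "(\<lambda>\<sigma>. map \<sigma> [0..<t]) ` {\<sigma>. \<sigma> permutes {..<t}} \<subseteq> permutations_of_set {..<t}"
  proof safe
    fix \<sigma> assume "\<sigma> permutes {..<t}"
    then show "map \<sigma> [0..<t] \<in> permutations_of_set {..<t}"
      by (auto simp: permutations_of_set_def distinct_map atLeast0LessThan permutes_image
          permutes_inj_on)
  qed
  show "(\<lambda>xs i. if i < t then xs ! i else i) ` permutations_of_set {..<t}
      \<subseteq> {\<sigma>. \<sigma> permutes {..<t}}"
  proof safe
    fix xs assume "xs \<in> permutations_of_set {..<t}"
    then have xs: "set xs = {..<t}" "distinct xs"
      by (auto simp: permutations_of_set_def)
    then have "length xs = t"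
      by (metis card_lessThan distinct_card)
    then have "bij_betw ((!) xs) {..<t} {..<t}"
      by (intro bij_betw_nth) (simp_all add: xs)
    then have "bij_betw (\<lambda>i. if i < t then xs ! i else i) {..<t} {..<t}"
      by (rule bij_betw_cong[THEN iffD1, rotated]) auto
    then show "(\<lambda>i. if i < t then xs ! i else i) permutes {..<t}"
      by (rule bij_imp_permutes) auto
  qed
  show "\<forall>\<sigma>\<in>{\<sigma>. \<sigma> permutes {..<t}}. (\<lambda>i. if i < t then map \<sigma> [0..<t] ! i else i) = \<sigma>"
    by (auto simp: fun_eq_iff permutes_def)
  show "\<forall>xs\<in>permutations_of_set {..<t}. map (\<lambda>i. if i < t then xs ! i else i) [0..<t] = xs"
  proof
    fix xs assume "xs \<in> permutations_of_set {..<t}"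
    then have "length xs = t"
      by (auto dest: length_finite_permutations_of_set)
    then show "map (\<lambda>i. if i < t then xs ! i else i) [0..<t] = xs"
      by (auto intro: nth_equalityI)
  qed
qed

subsection \<open>Coefficients in a quantum exterior algebra\<close>

text \<open>\<open>mul\<close> is abstract because the locale is used twice: with the given
  multiplication for column determinants and with the opposite one for row determinants.\<close>

locale q_exterior = vector_space scale
  for scale :: "'k::field \<Rightarrow> 'a::ring_1 \<Rightarrow> 'a" +
  fixes mul :: "'a \<Rightarrow> 'a \<Rightarrow> 'a" (infixl "\<star>" 70)
    and c :: 'k
  assumes mul_assoc: "x \<star> y \<star> z = x \<star> (y \<star> z)"
    and mul_add_left: "(x + y) \<star> z = x \<star> z + y \<star> z"
    and mul_add_right: "x \<star> (y + z) = x \<star> y + x \<star> z"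
    and mul_one_right [simp]: "x \<star> 1 = x"
    and mul_scale_left: "scale d x \<star> y = scale d (x \<star> y)"
    and mul_scale_right: "x \<star> scale d y = scale d (x \<star> y)"
begin

lemma mul_zero_left [simp]: "0 \<star> x = 0"
  using mul_add_left[of 0 0 x] by simp

lemma mul_zero_right [simp]: "x \<star> 0 = 0"
  using mul_add_right[of x 0 0] by simp

lemma mul_sum_left: "sum f A \<star> x = (\<Sum>i\<in>A. f i \<star> x)"
  by (induction A rule: infinite_finite_induct) (auto simp: mul_add_left)

lemma mul_sum_right: "x \<star> sum f A = (\<Sum>i\<in>A. x \<star> f i)"
  by (induction A rule: infinite_finite_induct) (auto simp: mul_add_right)

text \<open>
  An element of the exterior algebra on generators \<open>\<psi>\<^sub>0, \<psi>\<^sub>1, \<dots>\<close> with \<open>\<psi>\<^sub>b \<psi>\<^sub>a = c \<psi>\<^sub>a \<psi>\<^sub>b\<close> for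
  \<open>a < b\<close> is given by its coefficients, indexed by finite sets of generators multiplied in
  increasing order; \<open>ext f v\<close> is the product of \<open>f\<close> with \<open>\<Sum>\<^sub>l \<psi>\<^sub>l v\<^sub>l\<close>.
\<close>

definition ext :: "(nat set \<Rightarrow> 'a) \<Rightarrow> (nat \<Rightarrow> 'a) \<Rightarrow> nat set \<Rightarrow> 'a" where
  "ext f v J = (\<Sum>l\<in>J. scale (c ^ card {j \<in> J. l < j}) (f (J - {l}) \<star> v l))"

text \<open>Coefficients of the product of the vectors \<open>v 0\<close>, ...,
  \<open>v (t - 1)\<close>, starting from the unit of the exterior algebra.\<close>

primrec wedge :: "(nat \<Rightarrow> nat \<Rightarrow> 'a) \<Rightarrow> nat \<Rightarrow> nat set \<Rightarrow> 'a" where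
  "wedge v 0 = (\<lambda>J. if J = {} then 1 else 0)"
| "wedge v (Suc t) = ext (wedge v t) (v t)"

lemma ext_add: "ext f (\<lambda>l. v l + w l) J = ext f v J + ext f w J"
  by (simp add: ext_def mul_add_right scale_right_distrib sum.distrib)

text \<open>Multipliers at the far right factor out by associativity alone, with no commutation rule
  for \<open>x\<close>.\<close>

lemma ext_sum_mul: "ext f (\<lambda>l. \<Sum>i\<in>I. v i l \<star> x i) J = (\<Sum>i\<in>I. ext f (v i) J \<star> x i)"
  unfolding ext_def
  by (simp add: mul_sum_right mul_sum_left scale_sum_right mul_scale_left mul_assoc)
    (rule sum.swap)

lemma ext_cong:
  "(\<And>l. l \<in> J \<Longrightarrow> f (J - {l}) = g (J - {l})) \<Longrightarrow> (\<And>l. l \<in> J \<Longrightarrow> v l = w l) \<Longrightarrow> ext f v J = ext g w J"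
  by (simp add: ext_def)

text \<open>Grouping the two orders in which \<open>a < b\<close> can be removed shows that
  \<open>v\<close> and \<open>w\<close> enter only through 2x2 quantum minors. Relations between
  minors thus become relations between products of vectors.\<close>

lemma ext_ext:
  assumes "finite J"
  shows "ext (ext f v) w J =
    (\<Sum>(a, b) | a \<in> J \<and> b \<in> J \<and> a < b.
      scale (c ^ (card {j \<in> J. b < j} + card {j \<in> J - {b}. a < j}))
        (f (J - {a, b}) \<star> (v a \<star> w b + scale c (v b \<star> w a))))"
proof -
  have diff: "J - {l} - {l'} = J - {l', l}" for l l'
    by auto
  have "ext (ext f v) w J = (\<Sum>l\<in>J. \<Sum>l'\<in>J - {l}.
      scale (c ^ (card {j \<in> J. l < j} + card {j \<in> J - {l}. l' < j}))
        (f (J - {l', l}) \<star> (v l' \<star> w l)))"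
    unfolding ext_def
    by (simp add: mul_sum_left scale_sum_right mul_scale_left mul_assoc power_add diff)
  also have "\<dots> = (\<Sum>(a, b) | a \<in> J \<and> b \<in> J \<and> a < b.
      scale (c ^ (card {j \<in> J. b < j} + card {j \<in> J - {b}. a < j})) (f (J - {a, b}) \<star> (v a \<star> w b)) +
      scale (c ^ (card {j \<in> J. a < j} + card {j \<in> J - {a}. b < j})) (f (J - {b, a}) \<star> (v b \<star> w a)))"
    by (rule sum_distinct_pairs[OF assms])
  also have "\<dots> = (\<Sum>(a, b) | a \<in> J \<and> b \<in> J \<and> a < b.
      scale (c ^ (card {j \<in> J. b < j} + card {j \<in> J - {b}. a < j}))
        (f (J - {a, b}) \<star> (v a \<star> w b + scale c (v b \<star> w a))))"
  proof (rule sum.cong[OF refl], clarify)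
    fix a b assume ab: "a \<in> J" "b \<in> J" "a < b"
    \<comment> \<open>If \<open>a\<close> is removed before \<open>b\<close>, then \<open>b\<close>
      is counted once more; this is the extra factor \<open>c\<close> in the minor.\<close>
    have "{j \<in> J. a < j} = insert b {j \<in> J - {b}. a < j}"
      using ab by auto
    then have 1: "card {j \<in> J. a < j} = Suc (card {j \<in> J - {b}. a < j})"
      using assms by simp
    have 2: "{j \<in> J - {a}. b < j} = {j \<in> J. b < j}"
      using ab by auto
    show "scale (c ^ (card {j \<in> J. b < j} + card {j \<in> J - {b}. a < j}))
          (f (J - {a, b}) \<star> (v a \<star> w b)) +
        scale (c ^ (card {j \<in> J. a < j} + card {j \<in> J - {a}. b < j}))
          (f (J - {b, a}) \<star> (v b \<star> w a)) =
        scale (c ^ (card {j \<in> J. b < j} + card {j \<in> J - {b}. a < j}))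
          (f (J - {a, b}) \<star> (v a \<star> w b + scale c (v b \<star> w a)))"
      unfolding 1 2
      by (simp add: mul_add_right mul_scale_right scale_right_distrib insert_commute
          add.commute mult.commute)
  qed
  finally show ?thesis .
qed

section \<open>Vectors that square to zero and commute up to a scalar\<close>

text \<open>Read on minors, the first clause says that each vector squares to zero and the second
  that two vectors commute up to a scalar. Any \<open>d\<close> will do, since it only carries zero
  to zero.\<close>

definition manin :: "nat \<Rightarrow> (nat \<Rightarrow> nat \<Rightarrow> 'a) \<Rightarrow> bool" where
  "manin n v \<longleftrightarrow>
    (\<forall>i<n. \<forall>a b. a < b \<and> b < n \<longrightarrow> v i a \<star> v i b + scale c (v i b \<star> v i a) = 0) \<and>
    (\<exists>d. \<forall>i j a b. i < j \<and> j < n \<and> a < b \<and> b < n \<longrightarrow>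
      v j a \<star> v i b + scale c (v j b \<star> v i a) =
        scale d (v i a \<star> v j b + scale c (v i b \<star> v j a)))"

lemma ext_square_zero:
  assumes "manin n v" "i < n" "J \<subseteq> {..<n}"
  shows "ext (ext f (v i)) (v i) J = 0"
proof -
  have "finite J"
    using assms(3) finite_subset by blast
  with assms show ?thesis
    unfolding manin_def by (subst ext_ext) (auto intro!: sum.neutral)
qed

lemma ext_swap:
  assumes "manin n v"
  shows "\<exists>d. \<forall>i j f J. i < j \<and> j < n \<and> J \<subseteq> {..<n} \<longrightarrow>
    ext (ext f (v j)) (v i) J = scale d (ext (ext f (v i)) (v j) J)"
proof -
  obtain d where d: "\<And>i j a b. i < j \<Longrightarrow> j < n \<Longrightarrow> a < b \<Longrightarrow> b < n \<Longrightarrow>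
      v j a \<star> v i b + scale c (v j b \<star> v i a) =
        scale d (v i a \<star> v j b + scale c (v i b \<star> v j a))"
    using assms unfolding manin_def by meson
  have "ext (ext f (v j)) (v i) J = scale d (ext (ext f (v i)) (v j) J)"
    if "i < j" "j < n" "J \<subseteq> {..<n}" for i j f J
  proof -
    have "finite J"
      using that(3) finite_subset by blast
    moreover have "b < n" if "b \<in> J" for b
      using that \<open>J \<subseteq> {..<n}\<close> by auto
    ultimately show ?thesis
      using that(1,2)
      by (simp add: ext_ext scale_sum_right case_prod_beta)
        (rule sum.cong[OF refl], clarify, simp add: d mul_scale_right mult.commute)
  qed
  then show ?thesis
    by blast
qed

text \<open>The repeated vector moves left past the later factors, at the cost of scalars, until it
  meets its first copy.\<close>

lemma wedge_repeat_zero: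
  assumes "manin n v" "t \<le> n" "i < t" "J \<subseteq> {..<n}"
  shows "ext (wedge v t) (v i) J = 0"
proof -
  obtain d where d: "\<And>i j f J. i < j \<Longrightarrow> j < n \<Longrightarrow> J \<subseteq> {..<n} \<Longrightarrow>
    ext (ext f (v j)) (v i) J = scale d (ext (ext f (v i)) (v j) J)"
    using ext_swap[OF assms(1)] by meson
  show ?thesis
    using assms(2-4)
  proof (induction t arbitrary: J)
    case (Suc t)
    show ?case
    proof (cases "i = t")
      case True
      then show ?thesis
        using ext_square_zero[OF assms(1)] Suc.prems by simp
    next
      case False
      then have "ext (wedge v (Suc t)) (v i) J = scale d (ext (ext (wedge v t) (v i)) (v t) J)"
        using d Suc.prems by simp
      also have "ext (ext (wedge v t) (v i)) (v t) J = ext (\<lambda>_. 0) (v t) J"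
        by (rule ext_cong, rule Suc.IH) (use False Suc.prems in auto)
      finally show ?thesis
        by (simp add: ext_def)
    qed
  qed simp
qed

text \<open>The induction hypothesis exchanges the whole prefix, so only the last factor changes at
  each step and the multipliers \<open>x i j\<close> already stand at the far right.\<close>

lemma wedge_replace:
  assumes "manin n v" "k \<le> n" "t \<le> n"
    and low: "\<And>j l. j < k \<Longrightarrow> v' j l = v j l"
    and high: "\<And>j l. k \<le> j \<Longrightarrow> j < n \<Longrightarrow> l < n \<Longrightarrow> v j l = (\<Sum>i<k. v i l \<star> x i j) + v' j l"
    and "J \<subseteq> {..<n}"
  shows "wedge v' t J = wedge v t J"
  using assms(3,6)
proof (induction t arbitrary: J)
  case (Suc t)
  have IH: "wedge v' t (J - {l}) = wedge v t (J - {l})" for l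
    by (rule Suc.IH) (use Suc.prems in auto)
  show ?case
  proof (cases "t < k")
    case True
    then show ?thesis
      by (auto intro!: ext_cong simp: IH low)
  next
    case False
    have "wedge v (Suc t) J = ext (wedge v t) (\<lambda>l. (\<Sum>i<k. v i l \<star> x i t) + v' t l) J"
      using Suc.prems False high by (auto intro!: ext_cong)
    also have "\<dots> = (\<Sum>i<k. ext (wedge v t) (v i) J \<star> x i t) + ext (wedge v t) (v' t) J"
      by (simp add: ext_add ext_sum_mul)
    \<comment> \<open>Here \<open>i < k \<le> t\<close>, so \<open>v i\<close> is already a factor
      of \<open>wedge v t\<close>.\<close>
    also have "(\<Sum>i<k. ext (wedge v t) (v i) J \<star> x i t) = 0"
      using assms(1) Suc.prems False by (intro sum.neutral) (simp add: wedge_repeat_zero)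
    finally show ?thesis
      by (auto intro!: ext_cong simp: IH)
  qed
qed simp

section \<open>Block triangular systems\<close>

text \<open>Each factor contributes exactly one generator, so a product of \<open>t\<close> vectors
  is homogeneous of degree \<open>t\<close>.\<close>

lemma wedge_card_neq: "finite J \<Longrightarrow> card J \<noteq> t \<Longrightarrow> wedge v t J = 0"
proof (induction t arbitrary: J)
  case (Suc t)
  have "wedge v t (J - {l}) = 0" if "l \<in> J" for l
  proof (rule Suc.IH)
    show "card (J - {l}) \<noteq> t"
      using Suc.prems that by (metis card_Suc_Diff1)
  qed (use Suc.prems in simp)
  then show ?case
    by (simp add: ext_def)
qed auto

text \<open>The later factors involve only generators from \<open>k\<close> on. These follow all
  lower generators, so no scalar arises between the two blocks, and by degree the first
  \<open>k\<close> factors supply exactly the lower generators.\<close>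

lemma wedge_factor:
  assumes zero: "\<And>j l. l < k \<Longrightarrow> v (k + j) l = 0"
    and "finite J"
  shows "wedge v (k + t) ({..<k} \<union> (+) k ` J) =
    wedge v k {..<k} \<star> wedge (\<lambda>j l. v (k + j) (k + l)) t J"
  using assms(2)
proof (induction t arbitrary: J)
  case 0
  show ?case
  proof (cases "J = {}")
    case False
    have "card ({..<k} \<union> (+) k ` J) = k + card J"
      using 0 by (subst card_Un_disjoint) (auto simp: card_image)
    with False 0 show ?thesis
      by (simp add: wedge_card_neq)
  qed simp
next
  case (Suc t)
  let ?J = "{..<k} \<union> (+) k ` J"
  have "wedge v (k + Suc t) ?J = ext (wedge v (k + t)) (v (k + t)) ?J"
    by simp
  also have "\<dots> = (\<Sum>l\<in>(+) k ` J. scale (c ^ card {j \<in> ?J. l < j})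
      (wedge v (k + t) (?J - {l}) \<star> v (k + t) l))"
    unfolding ext_def using Suc.prems by (intro sum.mono_neutral_right) (auto simp: zero)
  also have "\<dots> = (\<Sum>l\<in>J. scale (c ^ card {j \<in> J. l < j})
      (wedge v (k + t) ({..<k} \<union> (+) k ` (J - {l})) \<star> v (k + t) (k + l)))"
  proof (subst sum.reindex, simp, rule sum.cong[OF refl], unfold o_def)
    fix l assume l: "l \<in> J"
    have "{j \<in> ?J. k + l < j} = (+) k ` {j \<in> J. l < j}"
      by auto
    then have "card {j \<in> ?J. k + l < j} = card {j \<in> J. l < j}"
      by (simp add: card_image)
    moreover have "?J - {k + l} = {..<k} \<union> (+) k ` (J - {l})"
      by auto
    ultimately show "scale (c ^ card {j \<in> ?J. k + l < j})
        (wedge v (k + t) (?J - {k + l}) \<star> v (k + t) (k + l)) =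
      scale (c ^ card {j \<in> J. l < j})
        (wedge v (k + t) ({..<k} \<union> (+) k ` (J - {l})) \<star> v (k + t) (k + l))"
      by simp
  qed
  also have "\<dots> = wedge v k {..<k} \<star> wedge (\<lambda>j l. v (k + j) (k + l)) (Suc t) J"
    using Suc by (simp add: ext_def mul_sum_right mul_scale_right mul_assoc)
  finally show ?case .
qed

lemma wedge_cong:
  "(\<And>i l. i < t \<Longrightarrow> l \<in> J \<Longrightarrow> v i l = w i l) \<Longrightarrow> wedge v t J = wedge w t J"
proof (induction t arbitrary: J)
  case (Suc t)
  have "wedge v t (J - {l}) = wedge w t (J - {l})" for l
    by (rule Suc.IH) (use Suc.prems in auto)
  then show ?case
    using Suc.prems by (auto intro!: ext_cong)
qed simp

text \<open>
  In the product \<open>\<phi>\<^sub>0 \<cdots> \<phi>\<^sub>n\<^sub>-\<^sub>1\<close> of the vectors \<open>\<phi>\<^sub>j = \<Sum>\<^sub>l \<psi>\<^sub>l v\<^sub>j\<^sub>l\<close>, each \<open>\<phi>\<^sub>j\<close> with \<open>j \<ge> k\<close> may be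
  reduced modulo right multiples of \<open>\<phi>\<^sub>0, \<dots>, \<phi>\<^sub>k\<^sub>-\<^sub>1\<close>: doing this from the last factor to the first,
  the multipliers \<open>x i j\<close> never have to be moved past anything.
\<close>

lemma wedge_schur:
  assumes "manin (k + t) v"
    and low: "\<And>j l. j < t \<Longrightarrow> l < k \<Longrightarrow> v (k + j) l = (\<Sum>i<k. v i l \<star> x i j)"
    and high: "\<And>j l. j < t \<Longrightarrow> l < t \<Longrightarrow>
      v (k + j) (k + l) = (\<Sum>i<k. v i (k + l) \<star> x i j) + u j l"
  shows "wedge v (k + t) {..<k + t} = wedge v k {..<k} \<star> wedge u t {..<t}"
proof -
  \<comment> \<open>The reduced system is block triangular: the coordinates below \<open>k\<close>
    cancel and the corner is \<open>u\<close>.\<close>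
  define v' where "v' j l = (if j < k then v j l else if l < k then 0 else u (j - k) (l - k))" for j l
  have "wedge v (k + t) {..<k + t} = wedge v' (k + t) {..<k + t}"
  proof (rule wedge_replace[OF assms(1), symmetric, of k])
    fix j l assume "k \<le> j" "j < k + t" "l < k + t"
    then obtain j' where "j = k + j'" "j' < t"
      using le_Suc_ex by fastforce
    moreover have "l < k \<or> (\<exists>l'<t. l = k + l')"
      using \<open>l < k + t\<close> by (metis add_less_cancel_left le_Suc_ex not_le)
    ultimately show "v j l = (\<Sum>i<k. v i l \<star> x i (j - k)) + v' j l"
      by (auto simp: v'_def low high)
  qed (auto simp: v'_def)
  also have "wedge v' (k + t) {..<k + t} = wedge v' (k + t) ({..<k} \<union> (+) k ` {..<t})"
    by (rule arg_cong[of _ _ "wedge v' (k + t)"]) (auto simp: lessThan_atLeast0)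
  also have "\<dots> = wedge v' k {..<k} \<star> wedge (\<lambda>j l. v' (k + j) (k + l)) t {..<t}"
    by (rule wedge_factor) (auto simp: v'_def)
  also have "wedge v' k {..<k} = wedge v k {..<k}"
    by (rule wedge_cong) (simp add: v'_def)
  also have "wedge (\<lambda>j l. v' (k + j) (k + l)) t {..<t} = wedge u t {..<t}"
    by (rule wedge_cong) (simp add: v'_def)
  finally show ?thesis .
qed

section \<open>Expansion of the product over permutations\<close>

text \<open>A list records the generator chosen from each factor. Its last entry \<open>l\<close>
  forms an inversion with every larger element of \<open>J\<close>, which matches the exponent in
  \<open>ext\<close>. The product is a \<open>foldl\<close> because \<open>mul\<close> may be the
  opposite product.\<close>

lemma wedge_permutations_of_set:
  assumes "finite J" "card J = t"
  shows "wedge v t J = (\<Sum>xs\<in>permutations_of_set J.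
    scale (c ^ inversions t ((!) xs)) (foldl (\<star>) 1 (map (\<lambda>j. v j (xs ! j)) [0..<t])))"
  using assms
proof (induction t arbitrary: J)
  case (Suc t)
  let ?f = "\<lambda>t xs. scale (c ^ inversions t ((!) xs)) (foldl (\<star>) 1 (map (\<lambda>j. v j (xs ! j)) [0..<t]))"
  have "(\<Sum>xs\<in>permutations_of_set J. ?f (Suc t) xs) =
      (\<Sum>l\<in>J. \<Sum>xs\<in>(\<lambda>ys. ys @ [l]) ` permutations_of_set (J - {l}). ?f (Suc t) xs)"
    using Suc.prems
    by (subst permutations_of_set_snoc, force) (rule sum.UNION_disjoint, auto)
  also have "\<dots> = (\<Sum>l\<in>J. \<Sum>ys\<in>permutations_of_set (J - {l}).
      scale (c ^ card {j \<in> J. l < j}) (?f t ys \<star> v t l))"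
  proof (rule sum.cong[OF refl], subst sum.reindex, simp add: inj_on_def, rule sum.cong[OF refl],
      unfold o_def)
    fix l ys assume l: "l \<in> J" and ys: "ys \<in> permutations_of_set (J - {l})"
    have len: "length ys = t"
      using length_finite_permutations_of_set[OF ys] Suc.prems l by simp
    have set: "set ys = J - {l}" "distinct ys"
      using ys by (auto simp: permutations_of_set_def)
    have "(!) ys ` {i. i < t \<and> l < ys ! i} = {j \<in> set ys. l < j}"
      using len by (auto simp: set_conv_nth)
    moreover have "{j \<in> set ys. l < j} = {j \<in> J. l < j}"
      using set by auto
    moreover have "inj_on ((!) ys) {i. i < t \<and> l < ys ! i}"
      using set len by (auto simp: inj_on_def nth_eq_iff_index_eq)
    ultimately have "card {j \<in> J. l < j} = card {i. i < t \<and> l < ys ! i}"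
      by (metis card_image)
    moreover have "{i. i < t \<and> (ys @ [l]) ! t < (ys @ [l]) ! i} = {i. i < t \<and> l < ys ! i}"
      using len by (auto simp: nth_append)
    moreover have "inversions t ((!) (ys @ [l])) = inversions t ((!) ys)"
      using len by (intro inversions_cong) (simp add: nth_append)
    ultimately have inv: "inversions (Suc t) ((!) (ys @ [l])) =
        card {j \<in> J. l < j} + inversions t ((!) ys)"
      by (simp add: inversions_Suc)
    have "map (\<lambda>j. v j ((ys @ [l]) ! j)) [0..<Suc t] = map (\<lambda>j. v j (ys ! j)) [0..<t] @ [v t l]"
      using len by (auto simp: nth_append)
    then show "?f (Suc t) (ys @ [l]) = scale (c ^ card {j \<in> J. l < j}) (?f t ys \<star> v t l)"
      by (simp add: inv power_add mul_scale_left del: upt_Suc)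
  qed
  also have "\<dots> = wedge v (Suc t) J"
    using Suc by (simp add: ext_def mul_sum_left scale_sum_right)
  finally show ?case
    by simp
qed simp

lemma wedge_permutes:
  "wedge v t {..<t} = (\<Sum>\<sigma> | \<sigma> permutes {..<t}.
    scale (c ^ inversions t \<sigma>) (foldl (\<star>) 1 (map (\<lambda>j. v j (\<sigma> j)) [0..<t])))"
proof -
  have 1: "inversions t ((!) (map \<sigma> [0..<t])) = inversions t \<sigma>" for \<sigma>
    by (rule inversions_cong) simp
  have 2: "map (\<lambda>j. v j (map \<sigma> [0..<t] ! j)) [0..<t] = map (\<lambda>j. v j (\<sigma> j)) [0..<t]" for \<sigma>
    by simp
  show ?thesis
    unfolding wedge_permutations_of_set[OF finite_lessThan card_lessThan]
      sum.reindex_bij_betw[OF bij_betw_permutes_permutations_of_set, symmetric] 1 2 ..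
qed

end

subsection \<open>Quantum determinants of the diagonal blocks\<close>

text \<open>Reversing positions and values together preserves inversions: a pair goes to its two
  mirror images in exchanged order.\<close>

lemma inversions_reverse:
  assumes "\<sigma> permutes {..<s}" "\<And>i. i < s \<Longrightarrow> \<tau> i = s - Suc (\<sigma> (s - Suc i))"
  shows "inversions s \<tau> = inversions s \<sigma>"
  unfolding inversions_def
proof (rule bij_betw_same_card)
  have \<sigma>: "\<sigma> i < s" if "i < s" for i
    using permutes_in_image[OF assms(1)] that by simp
  have \<tau>: "\<tau> j < \<tau> i \<longleftrightarrow> \<sigma> (s - Suc i) < \<sigma> (s - Suc j)" if "i < j" "j < s" for i j
    using assms(2) \<sigma>[of "s - Suc i"] \<sigma>[of "s - Suc j"] that by auto
  show "bij_betw (\<lambda>(i, j). (s - Suc j, s - Suc i))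
      {(i, j). i < j \<and> j < s \<and> \<tau> j < \<tau> i} {(i, j). i < j \<and> j < s \<and> \<sigma> j < \<sigma> i}"
    by (rule bij_betw_byWitness[of _ "\<lambda>(i, j). (s - Suc j, s - Suc i)"]) (auto simp: \<tau>)
qed

lemma foldl_times_eq_prod_list: "foldl (*) (a::'a::monoid_mult) xs = a * prod_list xs"
  by (induction xs arbitrary: a) (auto simp: mult.assoc)

lemma foldl_times_swap_eq_prod_list:
  "foldl (\<lambda>x y. y * x) (a::'a::monoid_mult) xs = prod_list (rev xs) * a"
  by (induction xs arbitrary: a) (auto simp: mult.assoc)

lemma q_super_manin_odd_row:
  assumes "q_super_manin scale G q m n A" "i < m + n" "k < m + n" "l < m + n" "par m i = 1"
  shows "A $$ (i, k) * A $$ (i, l) =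
    scale (q powi eps l k * (-1) ^ ((par m k + 1) * (par m l + 1))) (A $$ (i, l) * A $$ (i, k))"
  by (rule assms(1)[unfolded q_super_manin_def, THEN conjunct2, THEN conjunct2, THEN conjunct2,
      THEN conjunct1, rule_format]) (use assms(2-) in simp_all)

lemma q_super_manin_even_column:
  assumes "q_super_manin scale G q m n A" "i < m + n" "j < m + n" "k < m + n" "par m k = 0"
  shows "A $$ (i, k) * A $$ (j, k) =
    scale (q powi eps i j * (-1) ^ (par m i * par m j)) (A $$ (j, k) * A $$ (i, k))"
  by (rule assms(1)[unfolded q_super_manin_def, THEN conjunct2, THEN conjunct2, THEN conjunct2, THEN conjunct2,
      THEN conjunct1, rule_format]) (use assms(2-) in simp_all)

lemma q_super_manin_exchange:
  assumes "q_super_manin scale G q m n A" "i < m + n" "j < m + n" "k < m + n" "l < m + n"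
  shows "A $$ (i, j) * A $$ (k, l)
        - scale (q powi (eps i k + eps l j) *
              (-1) ^ ((par m i + par m j) * (par m k + par m l)))
            (A $$ (k, l) * A $$ (i, j)) =
      scale (q powi eps i k *
            (-1) ^ (par m i * par m k + par m j * par m k + par m i * par m j))
          (A $$ (k, j) * A $$ (i, l))
        - scale (q powi eps l j *
              (-1) ^ (par m j * par m k + par m j * par m l + par m k * par m l))
            (A $$ (i, l) * A $$ (k, j))"
  by (rule assms(1)[unfolded q_super_manin_def, THEN conjunct2, THEN conjunct2, THEN conjunct2, THEN conjunct2,
      THEN conjunct2, rule_format]) (use assms(2-) in simp_all)

locale q_superalgebra = superalgebra scale G
  for scale :: "'k::field \<Rightarrow> 'a::ring_1 \<Rightarrow> 'a" and G +
  fixes q :: 'k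
  assumes q_nonzero: "q \<noteq> 0"
begin

text \<open>The constant \<open>- inverse q\<close> makes \<open>c ^ inversions\<close> the weight
  of the Berezinian.\<close>

sublocale col: q_exterior scale "(*)" "- inverse q"
  by unfold_locales (auto simp: algebra_simps scale_mult_left scale_mult_right)

sublocale row: q_exterior scale "\<lambda>x y. y * x" "- inverse q"
  by unfold_locales (auto simp: algebra_simps scale_mult_left scale_mult_right)

lemma power_int_minus_q: "(- q) powi (- int n) = (- inverse q) ^ n"
  by (simp only: power_int_minus power_int_of_nat power_inverse inverse_minus_eq[symmetric])

lemma column_det_eq_wedge:
  "(\<Sum>\<sigma> | \<sigma> permutes {..<r}. scale ((- q) powi (- int (inversions r \<sigma>)))
      (prod_list (map (\<lambda>j. A (\<sigma> j) j) [0..<r]))) =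
    col.wedge (\<lambda>j l. A l j) r {..<r}"
  by (simp only: col.wedge_permutes foldl_times_eq_prod_list power_int_minus_q mult_1_left)

text \<open>
  The order of the factors and the order of the generators are both reversed, so that a row
  determinant becomes a column determinant over the opposite algebra with the same \<open>q\<close>.
\<close>

lemma row_det_eq_wedge:
  "(\<Sum>\<rho> | \<rho> permutes {..<s}. scale ((- q) powi (- int (inversions s \<rho>)))
      (prod_list (map (\<lambda>i. B i (\<rho> i)) [0..<s]))) =
    row.wedge (\<lambda>i l. B (s - Suc i) (s - Suc l)) s {..<s}"
proof -
  \<comment> \<open>\<open>w\<close> reverses the order of \<open>{..<s}\<close>; conjugation by it
    matches the two sums over permutations.\<close>
  define w where "w i = (if i < s then s - Suc i else i)" for i
  have w: "w permutes {..<s}"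
    by (rule bij_imp_permutes, rule bij_betw_byWitness[of _ w]) (auto simp: w_def)
  have ww [simp]: "w (w i) = i" for i
    by (auto simp: w_def)
  have conj: "w \<circ> \<sigma> \<circ> w permutes {..<s}" if "\<sigma> permutes {..<s}" for \<sigma>
    by (intro permutes_compose that w)
  show ?thesis
    unfolding row.wedge_permutes
  proof (rule sum.reindex_bij_witness[of _ "\<lambda>\<sigma>. w \<circ> \<sigma> \<circ> w" "\<lambda>\<sigma>. w \<circ> \<sigma> \<circ> w"])
    fix \<rho> assume "\<rho> \<in> {\<rho>. \<rho> permutes {..<s}}"
    then have \<rho>: "\<rho> permutes {..<s}"
      by simp
    have less: "\<rho> i < s" if "i < s" for i
      using permutes_in_image[OF \<rho>] that by simp
    have inv: "inversions s (w \<circ> \<rho> \<circ> w) = inversions s \<rho>"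
      by (rule inversions_reverse[OF \<rho>]) (simp add: w_def less)
    have "rev (map (\<lambda>j. B (s - Suc j) (s - Suc ((w \<circ> \<rho> \<circ> w) j))) [0..<s]) =
        map (\<lambda>i. B i (\<rho> i)) [0..<s]"
      by (rule nth_equalityI) (auto simp: rev_nth w_def less Suc_diff_Suc less_imp_le)
    then show "scale ((- inverse q) ^ inversions s (w \<circ> \<rho> \<circ> w))
        (foldl (\<lambda>x y. y * x) 1
          (map (\<lambda>j. B (s - Suc j) (s - Suc ((w \<circ> \<rho> \<circ> w) j))) [0..<s])) =
      scale ((- q) powi (- int (inversions s \<rho>))) (prod_list (map (\<lambda>i. B i (\<rho> i)) [0..<s]))"
      by (simp only: foldl_times_swap_eq_prod_list inv power_int_minus_q mult_1_right)
  qed (auto simp: fun_eq_iff conj)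
qed

lemma Ber_eq_wedge:
  "Ber scale q r s A = col.wedge (\<lambda>j l. A $$ (l, j)) r {..<r} *
    row.wedge (\<lambda>i l. mat_inv A $$ (r + (s - Suc i), r + (s - Suc l))) s {..<s}"
  unfolding Ber_def
  by (simp only: column_det_eq_wedge[of r "\<lambda>i j. A $$ (i, j)"]
      row_det_eq_wedge[of s "\<lambda>i j. mat_inv A $$ (r + i, r + j)"])

text \<open>Relation (4) divided by \<open>q\<close> and regrouped into two minors: the second
  clause of \<open>manin\<close> with \<open>d = - inverse q\<close>.\<close>

lemma exchange_relation:
  assumes "P - Q = scale (inverse q) R - scale q T"
  shows "T + scale (- inverse q) Q = scale (- inverse q) (P + scale (- inverse q) R)"
proof -
  have "scale (inverse q) (P - Q) = scale (inverse q) (scale (inverse q) R) - T"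
    by (simp add: assms scale_right_diff_distrib q_nonzero)
  then show ?thesis
    by (simp add: algebra_simps scale_right_distrib scale_right_diff_distrib scale_minus_left)
qed

text \<open>All indices are even, so the signs disappear. Relation (3) makes the squares vanish and
  relation (4) gives the exchange.\<close>

lemma manin_even_columns:
  assumes "q_super_manin scale G q r s A"
  shows "col.manin r (\<lambda>j l. A $$ (l, j))"
  unfolding col.manin_def
proof (intro conjI allI impI exI[of _ "- inverse q"], goal_cases)
  case (1 i a b)
  then have "A $$ (a, i) * A $$ (b, i) =
      scale (q powi eps a b * (-1) ^ (par r a * par r b)) (A $$ (b, i) * A $$ (a, i))"
    by (intro q_super_manin_even_column[OF assms]) (auto simp: par_def)
  with 1 show ?case
    by (simp add: eps_def par_def power_int_minus scale_minus_left)
next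
  case (2 i j a b)
  then have "A $$ (a, i) * A $$ (b, j)
        - scale (q powi (eps a b + eps j i) *
              (-1) ^ ((par r a + par r i) * (par r b + par r j)))
            (A $$ (b, j) * A $$ (a, i)) =
      scale (q powi eps a b *
            (-1) ^ (par r a * par r b + par r i * par r b + par r a * par r i))
          (A $$ (b, i) * A $$ (a, j))
        - scale (q powi eps j i *
              (-1) ^ (par r i * par r b + par r i * par r j + par r b * par r j))
            (A $$ (a, j) * A $$ (b, i))"
    by (intro q_super_manin_exchange[OF assms, of a i b j]) linarith+
  with 2 have "A $$ (a, i) * A $$ (b, j) - A $$ (b, j) * A $$ (a, i) =
      scale (inverse q) (A $$ (b, i) * A $$ (a, j)) - scale q (A $$ (a, j) * A $$ (b, i))"
    by (simp add: eps_def par_def power_int_minus)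
  then show ?case
    by (rule exchange_relation)
qed

text \<open>Relation (2) for \<open>inverse q\<close> makes the squares vanish. The opposite product
  alone would give the constant \<open>- q\<close>; the reversed order of the generators restores
  \<open>- inverse q\<close>.\<close>

lemma manin_odd_rows:
  assumes "q_super_manin scale G (inverse q) r s B"
  shows "row.manin s (\<lambda>i l. B $$ (r + (s - Suc i), r + (s - Suc l)))"
  unfolding row.manin_def
proof (intro conjI allI impI exI[of _ "- inverse q"], goal_cases)
  case (1 i a b)
  define i' a' b' where "i' = r + (s - Suc i)" and "a' = r + (s - Suc a)" and "b' = r + (s - Suc b)"
  have ord: "r \<le> i'" "r \<le> a'" "r \<le> b'" "i' < r + s" "a' < r + s" "b' < r + s" "b' < a'"
    using 1 by (auto simp: i'_def a'_def b'_def)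
  then have "B $$ (i', b') * B $$ (i', a') =
      scale (inverse q powi eps a' b' * (-1) ^ ((par r b' + 1) * (par r a' + 1)))
        (B $$ (i', a') * B $$ (i', b'))"
    by (intro q_super_manin_odd_row[OF assms]) (auto simp: par_def)
  with ord have "B $$ (i', b') * B $$ (i', a') = scale (inverse q) (B $$ (i', a') * B $$ (i', b'))"
    by (simp add: eps_def par_def)
  then show ?case
    by (fold i'_def a'_def b'_def) (simp add: scale_minus_left)
next
  case (2 i j a b)
  define i' j' a' b' where "i' = r + (s - Suc i)" and "j' = r + (s - Suc j)"
    and "a' = r + (s - Suc a)" and "b' = r + (s - Suc b)"
  have ord: "r \<le> i'" "r \<le> j'" "r \<le> a'" "r \<le> b'" "i' < r + s" "j' < r + s" "a' < r + s"
      "b' < r + s" "j' < i'" "b' < a'"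
    using 2 by (auto simp: i'_def j'_def a'_def b'_def)
  then have "B $$ (j', b') * B $$ (i', a')
        - scale (inverse q powi (eps j' i' + eps a' b') *
              (-1) ^ ((par r j' + par r b') * (par r i' + par r a')))
            (B $$ (i', a') * B $$ (j', b')) =
      scale (inverse q powi eps j' i' *
            (-1) ^ (par r j' * par r i' + par r b' * par r i' + par r j' * par r b'))
          (B $$ (i', b') * B $$ (j', a'))
        - scale (inverse q powi eps a' b' *
              (-1) ^ (par r b' * par r i' + par r b' * par r a' + par r i' * par r a'))
            (B $$ (j', a') * B $$ (i', b'))"
    by (intro q_super_manin_exchange[OF assms, of j' b' i' a']) linarith+
  \<comment> \<open>With all four indices odd, both coefficients on the right of relation (4) become
    negative, so the two terms trade places.\<close>
  with ord have "B $$ (j', b') * B $$ (i', a') - B $$ (i', a') * B $$ (j', b') =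
      scale (inverse q) (B $$ (j', a') * B $$ (i', b')) - scale q (B $$ (i', b') * B $$ (j', a'))"
    by (simp add: eps_def par_def power_int_minus scale_minus_left)
  then show ?case
    by (fold i'_def j'_def a'_def b'_def) (rule exchange_relation)
qed

end

subsection \<open>Inverses of block matrices\<close>

lemma mat_inv_eqI:
  assumes "A \<in> carrier_mat n n" "B \<in> carrier_mat n n" "A * B = 1\<^sub>m n" "B * A = 1\<^sub>m n"
  shows "mat_inv A = B"
  unfolding mat_inv_def
proof (rule the_equality)
  fix C assume "C \<in> carrier_mat (dim_col A) (dim_row A) \<and> inverts_mat A C \<and> inverts_mat C A"
  then have C: "C \<in> carrier_mat n n" "C * A = 1\<^sub>m n"
    using assms(1) by (auto simp: inverts_mat_def)
  have "C = C * (A * B)"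
    using C assms(3) by simp
  also have "\<dots> = B"
    using C assms(1,2) by (simp add: assoc_mult_mat[symmetric, of _ n n _ n _ n])
  finally show "C = B" .
qed (use assms in \<open>auto simp: inverts_mat_def\<close>)

lemma index_mult_mat_sum:
  "A \<in> carrier_mat a b \<Longrightarrow> B \<in> carrier_mat b c \<Longrightarrow> i < a \<Longrightarrow> j < c \<Longrightarrow>
    (A * B) $$ (i, j) = (\<Sum>l<b. A $$ (i, l) * B $$ (l, j))"
  by (auto simp: scalar_prod_def lessThan_atLeast0)

lemma four_block_mat_inject:
  assumes "A \<in> carrier_mat a c" "B \<in> carrier_mat a d" "C \<in> carrier_mat b c" "D \<in> carrier_mat b d"
    and "A' \<in> carrier_mat a c" "B' \<in> carrier_mat a d" "C' \<in> carrier_mat b c" "D' \<in> carrier_mat b d"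
    and eq: "four_block_mat A B C D = four_block_mat A' B' C' D'"
  shows "A = A'" "B = B'" "C = C'" "D = D'"
proof -
  have entry: "four_block_mat A B C D $$ (i, j) = four_block_mat A' B' C' D' $$ (i, j)" for i j
    by (simp add: eq)
  show "A = A'"
  proof (rule eq_matI)
    fix i j assume "i < dim_row A'" "j < dim_col A'"
    with assms(1-8) entry[of i j] show "A $$ (i, j) = A' $$ (i, j)"
      by (auto split: if_splits)
  qed (use assms in auto)
  show "B = B'"
  proof (rule eq_matI)
    fix i j assume "i < dim_row B'" "j < dim_col B'"
    with assms(1-8) entry[of i "c + j"] show "B $$ (i, j) = B' $$ (i, j)"
      by (auto split: if_splits)
  qed (use assms in auto)
  show "C = C'"
  proof (rule eq_matI)
    fix i j assume "i < dim_row C'" "j < dim_col C'"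
    with assms(1-8) entry[of "a + i" j] show "C $$ (i, j) = C' $$ (i, j)"
      by (auto split: if_splits)
  qed (use assms in auto)
  show "D = D'"
  proof (rule eq_matI)
    fix i j assume "i < dim_row D'" "j < dim_col D'"
    with assms(1-8) entry[of "a + i" "c + j"] show "D $$ (i, j) = D' $$ (i, j)"
      by (auto split: if_splits)
  qed (use assms in auto)
qed

lemma four_block_mult_eq_one:
  fixes A :: "'a::semiring_1 mat"
  assumes "A \<in> carrier_mat a a" "B \<in> carrier_mat a b" "C \<in> carrier_mat b a" "D \<in> carrier_mat b b"
    and "A' \<in> carrier_mat a a" "B' \<in> carrier_mat a b" "C' \<in> carrier_mat b a" "D' \<in> carrier_mat b b"
    and "four_block_mat A B C D * four_block_mat A' B' C' D' = 1\<^sub>m (a + b)"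
  shows "A * A' + B * C' = 1\<^sub>m a" "A * B' + B * D' = 0\<^sub>m a b"
    "C * A' + D * C' = 0\<^sub>m b a" "C * B' + D * D' = 1\<^sub>m b"
proof -
  have "four_block_mat (A * A' + B * C') (A * B' + B * D') (C * A' + D * C') (C * B' + D * D') =
      four_block_mat (1\<^sub>m a) (0\<^sub>m a b) (0\<^sub>m b a) (1\<^sub>m b)"
    using assms(9) by (simp add: mult_four_block_mat[OF assms(1-8)])
  note inject = four_block_mat_inject[OF _ _ _ _ _ _ _ _ this, of a a b b]
  show "A * A' + B * C' = 1\<^sub>m a" "A * B' + B * D' = 0\<^sub>m a b"
    "C * A' + D * C' = 0\<^sub>m b a" "C * B' + D * D' = 1\<^sub>m b"
    by (rule inject; use assms(1-8) in auto)+
qed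

lemma uminus_eq_of_add_eq_zero_mat:
  fixes A :: "'a::group_add mat"
  assumes "A \<in> carrier_mat a b" "B \<in> carrier_mat a b" "A + B = 0\<^sub>m a b"
  shows "A = - B"
proof (rule eq_matI)
  fix i j assume "i < dim_row (- B)" "j < dim_col (- B)"
  then have "i < a" "j < b"
    using assms(2) by auto
  moreover from this have "(A + B) $$ (i, j) = 0"
    using assms(3) by simp
  ultimately show "A $$ (i, j) = (- B) $$ (i, j)"
    using assms(1,2) by (simp add: eq_neg_iff_add_eq_0)
qed (use assms in auto)

text \<open>Multiplying the upper block equations of \<open>M N = 1\<close> by \<open>W\<close> on
  the left eliminates \<open>M11\<close>. The formulas for \<open>N12\<close> and \<open>W\<close>
  together exhibit \<open>W\<close> as the Schur complement of \<open>N22\<close>.\<close>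

lemma block_inverse:
  fixes M11 :: "'a::ring_1 mat"
  assumes M: "M11 \<in> carrier_mat a a" "M12 \<in> carrier_mat a b" "M21 \<in> carrier_mat b a"
      "M22 \<in> carrier_mat b b"
    and N: "N11 \<in> carrier_mat a a" "N12 \<in> carrier_mat a b" "N21 \<in> carrier_mat b a"
      "N22 \<in> carrier_mat b b"
    and MN: "four_block_mat M11 M12 M21 M22 * four_block_mat N11 N12 N21 N22 = 1\<^sub>m (a + b)"
    and NM: "four_block_mat N11 N12 N21 N22 * four_block_mat M11 M12 M21 M22 = 1\<^sub>m (a + b)"
    and W: "W \<in> carrier_mat a a" "M11 * W = 1\<^sub>m a" "W * M11 = 1\<^sub>m a"
  defines "X \<equiv> W * M12"
  shows "M12 = M11 * X" and "N12 = - (X * N22)" and "W = N11 + X * N21"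
    and "(M22 - M21 * X) * N22 = 1\<^sub>m b" and "N22 * (M22 - M21 * X) = 1\<^sub>m b"
proof -
  note MN = four_block_mult_eq_one[OF M N MN]
  note NM = four_block_mult_eq_one[OF N M NM]
  have X: "X \<in> carrier_mat a b"
    using W M by (simp add: X_def)
  show M12: "M12 = M11 * X"
    using M W by (simp add: X_def assoc_mult_mat[symmetric, of _ a a _ a _ b])
  have cancel: "W * (M11 * A) = A" if "A \<in> carrier_mat a c" for A c
    using M W that by (simp add: assoc_mult_mat[symmetric, of _ a a _ a _ c])
  have XA: "W * (M12 * A) = X * A" if "A \<in> carrier_mat b c" for A c
    using M W that by (simp add: X_def assoc_mult_mat[of _ a a _ b _ c])
  have "W * (M11 * N12 + M12 * N22) = 0\<^sub>m a b"
    using W by (simp add: MN)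
  then have "N12 + X * N22 = 0\<^sub>m a b"
    using M N W by (simp add: mult_add_distrib_mat[of _ a a _ b] cancel XA)
  then show N12: "N12 = - (X * N22)"
    using X N by (intro uminus_eq_of_add_eq_zero_mat) auto
  have "W * (M11 * N11 + M12 * N21) = W"
    using W by (simp add: MN)
  then show "W = N11 + X * N21"
    using M N W by (simp add: mult_add_distrib_mat[of _ a a _ a] cancel XA)
  \<comment> \<open>The lower left block of \<open>N M = 1\<close>; with
    \<open>M12 = M11 * X\<close> it turns \<open>N22 * M21 * X\<close> into
    \<open>- (N21 * M12)\<close>.\<close>
  have N21: "N22 * M21 = - (N21 * M11)"
    using M N NM(3) by (intro uminus_eq_of_add_eq_zero_mat)
      (auto simp: comm_add_mat[of "N22 * M21" b a])
  have "(M22 - M21 * X) * N22 = M22 * N22 - M21 * (X * N22)"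
    using M N X by (simp add: minus_mult_distrib_mat[of _ b b _ _ b])
  also have "\<dots> = M21 * N12 + M22 * N22"
  proof -
    have "M21 * N12 = - (M21 * (X * N22))"
      using M N X by (simp add: N12 uminus_mult_right_mat)
    then show ?thesis
      using M N X by (intro eq_matI) auto
  qed
  finally show "(M22 - M21 * X) * N22 = 1\<^sub>m b"
    by (simp add: MN)
  have "N22 * (M22 - M21 * X) = N22 * M22 - (N22 * M21) * X"
    using M N X by (simp add: mult_minus_distrib_mat[of _ b b _ b])
  also have "\<dots> = N21 * M12 + N22 * M22"
  proof -
    have "N22 * M21 * X = - (N21 * M12)"
      using M N X by (simp add: N21 M12 assoc_mult_mat[of _ b a _ a _ b])
    then show ?thesis
      using M N X by (intro eq_matI) auto
  qed
  finally show "N22 * (M22 - M21 * X) = 1\<^sub>m b"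
    by (simp add: NM)
qed

lemma split_block_index:
  assumes "split_block A r c = (A11, A12, A21, A22)"
    and "A \<in> carrier_mat (r + r') (c + c')"
  shows "\<And>i j. i < r \<Longrightarrow> j < c \<Longrightarrow> A11 $$ (i, j) = A $$ (i, j)"
    and "\<And>i j. i < r \<Longrightarrow> j < c' \<Longrightarrow> A12 $$ (i, j) = A $$ (i, c + j)"
    and "\<And>i j. i < r' \<Longrightarrow> j < c \<Longrightarrow> A21 $$ (i, j) = A $$ (r + i, j)"
    and "\<And>i j. i < r' \<Longrightarrow> j < c' \<Longrightarrow> A22 $$ (i, j) = A $$ (r + i, c + j)"
  using assms by (auto simp: split_block_def Let_def add.commute)

subsection \<open>The factorization of the Berezinian\<close>

theorem theorem4p6:
  fixes scale :: "'k::field \<Rightarrow> 'a::ring_1 \<Rightarrow> 'a"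
    and G :: "nat \<Rightarrow> 'a set"
    and q :: 'k
    and m n k r s r' s' :: nat
    and M N M11 M12 M21 M22 N11 N12 N21 N22 :: "'a mat"
  assumes "superalgebra scale G"
    and "q \<noteq> 0"
    and "generator_pair scale G q m n M N"
    and "k \<le> m + n"
    and "split_block M k k = (M11, M12, M21, M22)"
    and "split_block N k k = (N11, N12, N21, N22)"
    and "k \<le> m \<and> (r, s) = (k, 0) \<and> (r', s') = (m - k, n) \<or>
         m \<le> k \<and> (r, s) = (m, k - m) \<and> (r', s') = (0, m + n - k)"
    and "invertible_mat M11"
    and "generator_pair scale G q r s M11 (mat_inv M11)"
    and "invertible_mat N22"
    and "generator_pair scale G (inverse q) r' s' N22 (mat_inv N22)"
  shows "Ber scale q m n M =
    Ber scale q r s M11 * Ber scale q r' s' (M22 - M21 * mat_inv M11 * M12)"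
proof -
  interpret superalgebra scale G by fact
  interpret q_superalgebra scale G q
    by unfold_locales fact
  define b where "b = m + n - k"
  have mn: "m + n = k + b"
    using assms(4) by (simp add: b_def)
  have qM: "q_super_manin scale G q m n M" and qN: "q_super_manin scale G (inverse q) m n N"
    and MN: "M * N = 1\<^sub>m (k + b)" "N * M = 1\<^sub>m (k + b)"
    using assms(3) by (simp_all add: generator_pair_def mn)
  have M: "M \<in> carrier_mat (k + b) (k + b)" and N: "N \<in> carrier_mat (k + b) (k + b)"
    using qM qN by (simp_all add: q_super_manin_def mn)
  define W where "W = mat_inv M11"
  have rs: "r + s = k"
    using assms(7) by auto
  have W: "W \<in> carrier_mat k k" "M11 * W = 1\<^sub>m k" "W * M11 = 1\<^sub>m k"
    using assms(9) by (simp_all add: generator_pair_def q_super_manin_def W_def rs)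
  have cM: "M11 \<in> carrier_mat k k" "M12 \<in> carrier_mat k b" "M21 \<in> carrier_mat b k"
      "M22 \<in> carrier_mat b b"
    and bM: "M = four_block_mat M11 M12 M21 M22"
    using split_block[OF assms(5)] M by auto
  have cN: "N11 \<in> carrier_mat k k" "N12 \<in> carrier_mat k b" "N21 \<in> carrier_mat b k"
      "N22 \<in> carrier_mat b b"
    and bN: "N = four_block_mat N11 N12 N21 N22"
    using split_block[OF assms(6)] N by auto
  note iM = split_block_index[OF assms(5) M]
  note iN = split_block_index[OF assms(6) N]
  \<comment> \<open>\<open>X\<close> supplies the multipliers in both cases:
    \<open>M12 = M11 * X\<close> reduces columns of \<open>M\<close>, and
    \<open>N12 = - (X * N22)\<close> reduces rows of \<open>N\<close>.\<close>
  define X where "X = W * M12"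
  define S where "S = M22 - M21 * X"
  have X: "X \<in> carrier_mat k b"
    using W cM by (simp add: X_def)
  have S: "S \<in> carrier_mat b b"
    unfolding S_def by (rule minus_carrier_mat[OF mult_carrier_mat[OF cM(3) X]])
  note block = block_inverse[OF cM cN MN[unfolded bM bN] W, folded X_def]
  have inv_M: "mat_inv M = N"
    by (rule mat_inv_eqI[OF M N MN])
  have inv_S: "mat_inv S = N22"
    by (rule mat_inv_eqI[OF S cN(4)]) (simp_all add: S_def block)
  have schur: "M22 - M21 * mat_inv M11 * M12 = S"
    using W cM by (simp add: S_def X_def W_def[symmetric] assoc_mult_mat[of _ b k _ k _ b])
  let ?Dc = "\<lambda>A r. col.wedge (\<lambda>j l. A $$ (l, j)) r {..<r}"
  let ?rev = "\<lambda>A r s i l. A $$ (r + (s - Suc i), r + (s - Suc l))"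
  let ?Dr = "\<lambda>A r s. row.wedge (?rev A r s) s {..<s}"
  have Ber: "Ber scale q m n M = ?Dc M m * ?Dr N m n"
    "Ber scale q r s M11 = ?Dc M11 r * ?Dr W r s"
    "Ber scale q r' s' S = ?Dc S r' * ?Dr N22 r' s'"
    by (simp_all only: Ber_eq_wedge inv_M inv_S W_def)
  from assms(7) show ?thesis
  proof (elim disjE conjE)
    assume km: "k \<le> m" and "(r, s) = (k, 0)" "(r', s') = (m - k, n)"
    then have [simp]: "r = k" "s = 0" "r' = m - k" "s' = n"
      by auto
    have lt: "l < b" if "l < m - k" for l
      using that mn by linarith
    \<comment> \<open>Only the even block of \<open>S\<close>, of size \<open>m - k\<close>, enters
      here, although \<open>S\<close> has size \<open>b\<close>.\<close>
    have "?Dc M (k + (m - k)) = ?Dc M k * ?Dc S (m - k)"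
    proof (rule col.wedge_schur[where x = "\<lambda>i j. X $$ (i, j)"])
      show "col.manin (k + (m - k)) (\<lambda>j l. M $$ (l, j))"
        using manin_even_columns[OF qM] km by simp
    next
      fix j l assume jl: "j < m - k" "l < k"
      have "M $$ (l, k + j) = (M11 * X) $$ (l, j)"
        using jl lt by (simp add: iM(2)[symmetric] block(1)[symmetric])
      then show "M $$ (l, k + j) = (\<Sum>i<k. M $$ (l, i) * X $$ (i, j))"
        using jl lt by (simp add: index_mult_mat_sum[OF cM(1) X] iM)
    next
      fix j l assume jl: "j < m - k" "l < m - k"
      have "M22 $$ (l, j) = (M21 * X) $$ (l, j) + S $$ (l, j)"
        using jl lt cM X by (simp add: S_def)
      then show "M $$ (k + l, k + j) = (\<Sum>i<k. M $$ (k + l, i) * X $$ (i, j)) + S $$ (l, j)"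
        using jl lt by (simp add: index_mult_mat_sum[OF cM(3) X] iM)
    qed
    moreover have "?Dc M k = ?Dc M11 k"
      by (rule col.wedge_cong) (simp add: iM)
    moreover have "?Dr N m n = ?Dr N22 (m - k) n"
    proof (rule row.wedge_cong)
      fix i l assume "i < n" "l \<in> {..<n}"
      then show "?rev N m n i l = ?rev N22 (m - k) n i l"
        using km mn by (subst iN) (auto simp: add.assoc[symmetric])
    qed
    ultimately show ?thesis
      using km unfolding schur Ber by (simp add: mult.assoc)
  next
    assume mk: "m \<le> k" and "(r, s) = (m, k - m)" "(r', s') = (0, m + n - k)"
    then have [simp]: "r = m" "s = k - m" "r' = 0" "s' = b"
      by (auto simp: b_def)
    \<comment> \<open>\<open>t\<close> counts the odd indices in the first block, so the odd block
      of \<open>N\<close> splits as \<open>t + b\<close>.\<close>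
    define t where "t = k - m"
    have n: "n = b + t"
      using mk mn by (simp add: t_def)
    have k: "k = m + t"
      using mk by (simp add: t_def)
    \<comment> \<open>The entries of \<open>- X\<close>, with both indices reversed as in
      \<open>?rev\<close>.\<close>
    let ?x = "\<lambda>i j. - X $$ (m + (t - Suc j), b - Suc i)"
    \<comment> \<open>Reversal puts the \<open>b\<close> rows of \<open>N22\<close> first. In the
      opposite product the remaining factor lands on the left, which is the order of the two
      Berezinians.\<close>
    have "?Dr N m (b + t) = ?Dr W m t * row.wedge (?rev N m (b + t)) b {..<b}"
    proof (rule row.wedge_schur[where x = ?x])
      show "row.manin (b + t) (?rev N m (b + t))"
        using manin_odd_rows[OF qN] by (simp add: n)
    next
      fix j l assume jl: "j < t" "l < b"
      have "?rev N m (b + t) (b + j) l = N12 $$ (m + (t - Suc j), b - Suc l)"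
        using jl by (subst iN(2)) (auto simp: k intro!: arg_cong[of _ _ "\<lambda>i. N $$ (_, i)"])
      also have "\<dots> = (\<Sum>i<b. - X $$ (m + (t - Suc j), i) * N22 $$ (i, b - Suc l))"
        using jl X cN by (simp add: block(2) index_mult_mat_sum[OF X cN(4)] k sum_negf
            del: index_mult_mat(1))
      also have "\<dots> = (\<Sum>i<b. ?x i j * N22 $$ (b - Suc i, b - Suc l))"
        by (rule sum.nat_diff_reindex[symmetric])
      also have "\<dots> = (\<Sum>i<b. ?x i j * ?rev N m (b + t) i l)"
        using jl by (intro sum.cong refl) (subst iN(4), auto simp: k algebra_simps)
      finally show "?rev N m (b + t) (b + j) l = (\<Sum>i<b. ?x i j * ?rev N m (b + t) i l)" .
    next
      fix j l assume jl: "j < t" "l < t"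
      have "?rev N m (b + t) (b + j) (b + l) = N11 $$ (m + (t - Suc j), m + (t - Suc l))"
        using jl by (subst iN(1)) (auto simp: k)
      \<comment> \<open>\<open>W = N11 + X * N21\<close> solved for \<open>N11\<close>: the odd
        block of \<open>W\<close> is the remainder \<open>u\<close> of the reduction.\<close>
      also have "\<dots> = - (X * N21) $$ (m + (t - Suc j), m + (t - Suc l)) + ?rev W m t j l"
        using jl X cN by (simp add: block(3) k)
      also have "(X * N21) $$ (m + (t - Suc j), m + (t - Suc l)) =
          (\<Sum>i<b. X $$ (m + (t - Suc j), i) * N21 $$ (i, m + (t - Suc l)))"
        using jl by (intro index_mult_mat_sum[OF X cN(3)]) (auto simp: k)
      also have "- \<dots> = (\<Sum>i<b. - X $$ (m + (t - Suc j), i) * N21 $$ (i, m + (t - Suc l)))"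
        by (simp add: sum_negf)
      also have "\<dots> = (\<Sum>i<b. ?x i j * N21 $$ (b - Suc i, m + (t - Suc l)))"
        by (rule sum.nat_diff_reindex[symmetric])
      also have "\<dots> = (\<Sum>i<b. ?x i j * ?rev N m (b + t) i (b + l))"
        using jl by (intro sum.cong refl) (subst iN(3), auto simp: k algebra_simps)
      finally show "?rev N m (b + t) (b + j) (b + l) =
        (\<Sum>i<b. ?x i j * ?rev N m (b + t) i (b + l)) + ?rev W m t j l" .
    qed
    moreover have "row.wedge (?rev N m (b + t)) b {..<b} = ?Dr N22 0 b"
    proof (rule row.wedge_cong)
      fix i l assume "i < b" "l \<in> {..<b}"
      then show "?rev N m (b + t) i l = ?rev N22 0 b i l"
        by (subst iN(4)) (auto simp: k algebra_simps)
    qed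
    moreover have "?Dc M m = ?Dc M11 m"
      using mk by (intro col.wedge_cong) (simp add: iM)
    ultimately show ?thesis
      unfolding schur Ber by (simp add: mult.assoc n k)
  qed
qed

end
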